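(* Let $\mathcal B(w)=w-u$ with a constant $u\in(-1,1)$, and let $f^\infty$ be a positive stationary state of $\partial_t f=\partial_w\left[(w-u)f+\partial_w(D(w)f)\right]$ on $I=[-1,1]$, as described in the context. Let $f_0(t),\dots,f_N(t)>0$ be a solution of the semi-discrete scheme $$\frac{d}{dt}f_i(t)=\frac{\mathcal F_{i+1/2}(t)-\mathcal F_{i-1/2}(t)}{\Delta w},\qquad i=0,\dots,N,\qquad \mathcal F_{-1/2}=\mathcal F_{N+1/2}=0,$$ where for $i=0,\dots,N-1$ $$\mathcal F_{i+1/2}=\tilde{\mathcal C}_{i+1/2}\left[(1-\delta_{i+1/2})f_{i+1}+\delta_{i+1/2}f_i\right]+D_{i+1/2}\frac{f_{i+1}-f_i}{\Delta w},$$ with $\tilde{\mathcal C}_{i+1/2}$ and $\delta_{i+1/2}$ as defined in the context. Then this numerical flux satisfies the discrete entropy dissipation $$\frac{d}{dt}\mathcal H_\Delta(f,f^\infty)=-\mathcal I_\Delta(f,f^\infty),$$ where $$\mathcal H_\Delta(f,f^\infty)=\Delta w\sum_{i=0}^N f_i\log\left(\frac{f_i}{f_i^\infty}\right)$$ and $\mathcal I_\Delta$ is the positive discrete dissipation function $$\mathcal I_\Delta(f,f^\infty)=\sum_{i=0}^{N-1}\left[\log\left(\frac{f_{i+1}}{f_{i+1}^\infty}\right)-\log\left(\frac{f_i}{f_i^\infty}\right)\right]\left(\frac{f_{i+1}}{f_{i+1}^\infty}-\frac{f_i}{f_i^\infty}\right)\hat f^\infty_{i+1/2}D_{i+1/2}\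 \ge 0 .$$
   Context: Grid: $w_0<w_1<\dots<w_N$ are points of $I=[-1,1]$ with uniform spacing $w_{i+1}-w_i=\Delta w>0$, and $w_{i+1/2}=w_i+\Delta w/2$. The diffusion function $D\ge 0$ is differentiable and strictly positive at the interior points of the domain; $D'=\partial_w D$ and $D_{i+1/2}=D(w_{i+1/2})$. For $i=0,\dots,N-1$ define $$\lambda_{i+1/2}=\int_{w_i}^{w_{i+1}}\frac{\mathcal B(w)+D'(w)}{D(w)}\,dw,\qquad \tilde{\mathcal C}_{i+1/2}=\frac{D_{i+1/2}}{\Delta w}\lambda_{i+1/2},\qquad \delta_{i+1/2}=\frac{1}{\lambda_{i+1/2}}+\frac{1}{1-\exp(\lambda_{i+1/2})},$$ where the integrals are assumed finite, and $\delta_{i+1/2}=1/2$ (the continuous extension) if $\lambda_{i+1/2}=0$. Stationary state: $f^\infty$ is a positive function with vanishing flux, $D(w)\partial_w f^\infty(w)=-(\mathcal B(w)+D'(w))f^\infty(w)$, assumed to exist; $f_i^\infty=f^\infty(w_i)$, so that $\log f_i^\infty-\log f_{i+1}^\infty=\lambda_{i+1/2}$. Moreover $$\hat f^\infty_{i+1/2}=\frac{f^\infty_{i+1}f^\infty_i}{f^\infty_{i+1}-f^\infty_i}\log\left(\frac{f^\infty_{i+1}}{f^\infty_i}\right),$$ understood as its continuous extension $\hat f^\infty_{i+1/2}=f^\infty_i$ when $f^\infty_{i+1}=f^\infty_i$.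
   Formalization: The dissipation identity is proved as dH_Δ/dt = −I_Δ/Δw instead of −I_Δ; with H_Δ, I_Δ and the flux as defined, the stated identity is false unless Δw = 1 or I_Δ = 0, since the factor 1/Δw of the flux is missing from I_Δ. *)

theory Defs
  imports "HOL-Analysis.Analysis"
begin

text \<open>
  Conventions: \<open>w i\<close> (\<open>i \<le> N\<close>) are the grid points, \<open>dw\<close> is the uniform spacing, and an
  index \<open>i\<close> of a quantity living on cell interfaces stands for \<open>i + 1/2\<close>.
\<close>

definition uniform_grid :: "(nat \<Rightarrow> real) \<Rightarrow> nat \<Rightarrow> real \<Rightarrow> bool" where
  "uniform_grid w N dw \<longleftrightarrow>
     0 < dw \<and> (\<forall>i\<le>N. w i \<in> {-1..1}) \<and> (\<forall>i<N. w (Suc i) - w i = dw)"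

definition diffusion_function :: "(real \<Rightarrow> real) \<Rightarrow> bool" where
  "diffusion_function D \<longleftrightarrow>
     (\<forall>x\<in>{-1..1}. 0 \<le> D x) \<and> (\<forall>x\<in>{-1<..<1}. D differentiable (at x) \<and> 0 < D x)"

definition D_mid :: "(real \<Rightarrow> real) \<Rightarrow> (nat \<Rightarrow> real) \<Rightarrow> real \<Rightarrow> nat \<Rightarrow> real" where
  "D_mid D w dw i = D (w i + dw / 2)"

definition drift_ratio :: "(real \<Rightarrow> real) \<Rightarrow> (real \<Rightarrow> real) \<Rightarrow> real \<Rightarrow> real" where
  "drift_ratio B D x = (B x + deriv D x) / D x"

text \<open>
  The integral is the Henstock--Kurzweil one; it agrees with the Lebesgue integral whenever the
  latter exists, and covers improper integrals at the end points of \<open>[-1,1]\<close>, where \<open>D\<close> may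
  vanish and need not be differentiable.
\<close>

definition lam :: "(real \<Rightarrow> real) \<Rightarrow> (real \<Rightarrow> real) \<Rightarrow> (nat \<Rightarrow> real) \<Rightarrow> nat \<Rightarrow> real" where
  "lam B D w i = integral {w i..w (Suc i)} (drift_ratio B D)"

definition C_tilde ::
    "(real \<Rightarrow> real) \<Rightarrow> (real \<Rightarrow> real) \<Rightarrow> (nat \<Rightarrow> real) \<Rightarrow> real \<Rightarrow> nat \<Rightarrow> real" where
  "C_tilde B D w dw i = D_mid D w dw i / dw * lam B D w i"

definition delta :: "(real \<Rightarrow> real) \<Rightarrow> (real \<Rightarrow> real) \<Rightarrow> (nat \<Rightarrow> real) \<Rightarrow> nat \<Rightarrow> real" where
  "delta B D w i =
     (if lam B D w i = 0 then 1 / 2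
      else 1 / lam B D w i + 1 / (1 - exp (lam B D w i)))"

definition num_flux ::
    "(real \<Rightarrow> real) \<Rightarrow> (real \<Rightarrow> real) \<Rightarrow> (nat \<Rightarrow> real) \<Rightarrow> real \<Rightarrow> (nat \<Rightarrow> real) \<Rightarrow> nat \<Rightarrow> real" where
  "num_flux B D w dw g i =
     C_tilde B D w dw i * ((1 - delta B D w i) * g (Suc i) + delta B D w i * g i)
     + D_mid D w dw i * ((g (Suc i) - g i) / dw)"

definition right_flux ::
    "(real \<Rightarrow> real) \<Rightarrow> (real \<Rightarrow> real) \<Rightarrow> (nat \<Rightarrow> real) \<Rightarrow> real \<Rightarrow> nat \<Rightarrow> (nat \<Rightarrow> real) \<Rightarrow> nat \<Rightarrow> real"
  where "right_flux B D w dw N g i = (if i < N then num_flux B D w dw g i else 0)"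

definition left_flux ::
    "(real \<Rightarrow> real) \<Rightarrow> (real \<Rightarrow> real) \<Rightarrow> (nat \<Rightarrow> real) \<Rightarrow> real \<Rightarrow> (nat \<Rightarrow> real) \<Rightarrow> nat \<Rightarrow> real"
  where "left_flux B D w dw g i = (if i = 0 then 0 else num_flux B D w dw g (i - 1))"

definition scheme_solution ::
    "(real \<Rightarrow> real) \<Rightarrow> (real \<Rightarrow> real) \<Rightarrow> (nat \<Rightarrow> real) \<Rightarrow> real \<Rightarrow> nat \<Rightarrow> real set
      \<Rightarrow> (nat \<Rightarrow> real \<Rightarrow> real) \<Rightarrow> bool" where
  "scheme_solution B D w dw N T f \<longleftrightarrow>
     (\<forall>t\<in>T. \<forall>i\<le>N.
        (f i has_real_derivative
           (right_flux B D w dw N (\<lambda>j. f j t) i - left_flux B D w dw (\<lambda>j. f j t) i) / dw)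
        (at t within T))"

text \<open>
  A positive stationary state with vanishing flux. The set \<open>J\<close> is where the state is required to be
  continuous and positive; the flux vanishes in the interior of \<open>[-1,1]\<close>. Taking
  \<open>J = [-1,1]\<close> would exclude states that vanish at \<open>-1\<close> or \<open>1\<close> (for instance for
  \<open>D x = (1 - x\<^sup>2)\<^sup>2\<close>) even on grids that avoid these points.
\<close>

definition positive_stationary_state ::
    "(real \<Rightarrow> real) \<Rightarrow> (real \<Rightarrow> real) \<Rightarrow> real set \<Rightarrow> (real \<Rightarrow> real) \<Rightarrow> bool" where
  "positive_stationary_state B D J finf \<longleftrightarrow>
     continuous_on J finf \<and> (\<forall>x\<in>J. 0 < finf x) \<and>
     (\<forall>x\<in>{-1<..<1}. finf differentiable (at x) \<and>
        D x * deriv finf x = - (B x + deriv D x) * finf x)"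

definition f_hat :: "(nat \<Rightarrow> real) \<Rightarrow> nat \<Rightarrow> real" where
  "f_hat ginf i =
     (if ginf (Suc i) = ginf i then ginf i
      else ginf (Suc i) * ginf i / (ginf (Suc i) - ginf i) * ln (ginf (Suc i) / ginf i))"

definition H_Delta :: "real \<Rightarrow> nat \<Rightarrow> (nat \<Rightarrow> real) \<Rightarrow> (nat \<Rightarrow> real) \<Rightarrow> real" where
  "H_Delta dw N g ginf = dw * (\<Sum>i\<le>N. g i * ln (g i / ginf i))"

definition I_Delta ::
    "(real \<Rightarrow> real) \<Rightarrow> (nat \<Rightarrow> real) \<Rightarrow> real \<Rightarrow> nat \<Rightarrow> (nat \<Rightarrow> real) \<Rightarrow> (nat \<Rightarrow> real) \<Rightarrow> real" where
  "I_Delta D w dw N g ginf =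
     (\<Sum>i<N. (ln (g (Suc i) / ginf (Suc i)) - ln (g i / ginf i))
              * (g (Suc i) / ginf (Suc i) - g i / ginf i)
              * f_hat ginf i * D_mid D w dw i)"

text \<open>
  The flux \<open>num_flux\<close> equals \<open>D_mid / dw * f_hat * (g (Suc i) / ginf (Suc i) - g i / ginf i)\<close>.
  Its prefactor \<open>1 / dw\<close> is not part of \<open>I_Delta\<close>, so the entropy \<open>H_Delta\<close>, which is weighted by
  \<open>dw\<close>, decays along the scheme at the rate \<open>I_Delta / dw\<close>, not \<open>I_Delta\<close>.
\<close>

end

theory Submission
  imports Defs
begin

text \<open>
  The vanishing flux makes \<open>- ln finf\<close> a primitive of the drift ratio, so \<open>exp (lam i)\<close> is the ratio
  of neighbouring values of the stationary state. This turns the numerical flux into a multiple of the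
  difference of the quotients \<open>f / finf\<close>. Differentiating the entropy and summing by parts
  pairs this difference with that of \<open>ln (f / finf)\<close>, which has the same sign.
\<close>

lemma uniform_grid_less:
  assumes "uniform_grid w N dw" "i < N"
  shows "w i < w (Suc i)"
proof -
  have "0 < dw" "w (Suc i) - w i = dw"
    using assms by (auto simp: uniform_grid_def)
  then show ?thesis by linarith
qed

lemma uniform_grid_mono:
  assumes "uniform_grid w N dw" "i \<le> j" "j \<le> N"
  shows "w i \<le> w j"
  using \<open>i \<le> j\<close> \<open>j \<le> N\<close>
proof (induction j rule: dec_induct)
  case (step j)
  then show ?case using uniform_grid_less[OF assms(1), of j] by simp
qed simp

lemma uniform_grid_cell_subset:
  assumes "uniform_grid w N dw" "i < N"
  shows "{w i..w (Suc i)} \<subseteq> {w 0..w N}"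
  using uniform_grid_mono[OF assms(1), of 0 i] uniform_grid_mono[OF assms(1), of "Suc i" N] assms(2)
  by auto

lemma uniform_grid_open_cell_subset:
  assumes "uniform_grid w N dw" "i < N"
  shows "{w i<..<w (Suc i)} \<subseteq> {-1<..<1}"
proof -
  have "w i \<in> {-1..1}" "w (Suc i) \<in> {-1..1}"
    using assms by (auto simp: uniform_grid_def)
  then show ?thesis by auto
qed

text \<open>The midpoint of a cell lies strictly between two points of [-1,1], hence in the open
  interval, where \<open>D\<close> is strictly positive even if it vanishes at an end point.\<close>

lemma D_mid_pos:
  assumes "uniform_grid w N dw" "diffusion_function D" "i < N"
  shows "0 < D_mid D w dw i"
proof -
  have "0 < dw" "w (Suc i) - w i = dw"
    using assms by (auto simp: uniform_grid_def)
  then have "w i + dw / 2 \<in> {w i<..<w (Suc i)}" by auto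
  then show ?thesis
    using uniform_grid_open_cell_subset[OF assms(1,3)] assms(2)
    unfolding D_mid_def diffusion_function_def by blast
qed

text \<open>Dividing the vanishing flux by \<open>D x * finf x\<close> shows that
  \<open>- ln finf\<close> has derivative \<open>drift_ratio B D x\<close>, so \<open>lam\<close> is
  its increment over the cell.\<close>

lemma lam_stationary:
  assumes grid: "uniform_grid w N dw" and D: "diffusion_function D"
    and finf: "positive_stationary_state B D J finf"
    and J: "{w 0..w N} \<subseteq> J" and i: "i < N"
  shows "lam B D w i = ln (finf (w i)) - ln (finf (w (Suc i)))"
proof -
  note cell = uniform_grid_cell_subset[OF grid i] and inner = uniform_grid_open_cell_subset[OF grid i]
  have cont: "continuous_on {w i..w (Suc i)} finf" and pos: "\<And>x. x \<in> {w i..w (Suc i)} \<Longrightarrow> 0 < finf x"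
    using finf cell J unfolding positive_stationary_state_def
    by (blast intro: continuous_on_subset)+
  have "(drift_ratio B D has_integral - ln (finf (w (Suc i))) - - ln (finf (w i))) {w i..w (Suc i)}"
  \<comment> \<open>This version asks for differentiability only inside the cell and continuity on
    the closed cell, so cells touching -1 or 1 are covered.\<close>
  proof (rule fundamental_theorem_of_calculus_interior)
    show "w i \<le> w (Suc i)" using uniform_grid_less[OF grid i] by simp
    show "continuous_on {w i..w (Suc i)} (\<lambda>x. - ln (finf x))"
      using pos by (intro continuous_intros cont) force
    fix x assume x: "x \<in> {w i<..<w (Suc i)}"
    then have x': "x \<in> {-1<..<1}" using inner by blast
    have fx: "0 < finf x" using pos x by simp
    have Dx: "0 < D x" using D x' unfolding diffusion_function_def by blast
    have diff: "finf differentiable (at x)"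
      and eq: "D x * deriv finf x = - (B x + deriv D x) * finf x"
      using finf x' unfolding positive_stationary_state_def by blast+
    have "(finf has_real_derivative deriv finf x) (at x)"
      using diff DERIV_deriv_iff_real_differentiable by blast
    then have "((\<lambda>x. - ln (finf x)) has_real_derivative - (1 / finf x * deriv finf x)) (at x)"
      using fx by (auto intro!: derivative_eq_intros)
    moreover have "- (1 / finf x * deriv finf x) = drift_ratio B D x"
      unfolding drift_ratio_def using eq fx Dx by (simp add: field_simps)
    ultimately show "((\<lambda>x. - ln (finf x)) has_vector_derivative drift_ratio B D x) (at x)"
      by (simp add: has_real_derivative_iff_has_vector_derivative)
  qed
  then show ?thesis unfolding lam_def by (simp add: integral_unique)
qed

text \<open>The difference in the denominator and the logarithm of the quotient always have the same
  sign.\<close>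

lemma f_hat_pos:
  assumes "0 < ginf i" "0 < ginf (Suc i)"
  shows "0 < f_hat ginf i"
proof -
  consider "ginf (Suc i) = ginf i" | "ginf (Suc i) < ginf i" | "ginf i < ginf (Suc i)" by linarith
  then show ?thesis
  proof cases
    case 2
    then have "ln (ginf (Suc i) / ginf i) < 0"
      using assms by (intro ln_less_zero) auto
    then show ?thesis
      using assms 2 by (auto simp: f_hat_def intro!: divide_neg_neg mult_pos_neg)
  next
    case 3
    then show ?thesis
      using assms by (auto simp: f_hat_def intro!: mult_pos_pos divide_pos_pos)
  qed (use assms in \<open>simp add: f_hat_def\<close>)
qed

text \<open>The weight \<open>delta\<close> is tuned so that the flux vanishes on
  \<open>ginf\<close>: as a linear form in the two neighbouring values, the flux is then a multiple
  of the difference of the quotients by \<open>ginf\<close>.\<close>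

lemma num_flux_eq_f_hat:
  assumes lam: "lam B D w i = ln (ginf i) - ln (ginf (Suc i))"
    and pos: "0 < ginf i" "0 < ginf (Suc i)"
  shows "num_flux B D w dw g i
    = D_mid D w dw i / dw * f_hat ginf i * (g (Suc i) / ginf (Suc i) - g i / ginf i)"
proof (cases "ginf (Suc i) = ginf i")
  \<comment> \<open>Here \<open>lam\<close> is 0, so only the diffusive part survives, and
    \<open>f_hat ginf i = ginf i\<close> cancels the common denominator.\<close>
  case True
  then show ?thesis
    using lam pos by (simp add: num_flux_def C_tilde_def f_hat_def flip: diff_divide_distrib)
next
  case False
  define l a b where "l = lam B D w i" and "a = ginf i" and "b = ginf (Suc i)"
  have ab: "0 < a" "0 < b" "a \<noteq> b" "b - a \<noteq> 0"
    using pos False by (auto simp: a_def b_def)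
  have exp_l: "exp l = a / b"
    using lam ab by (simp add: l_def a_def b_def exp_diff)
  have ln_ba: "ln (b / a) = - l"
    using lam ab by (simp add: l_def a_def b_def ln_div)
  have l0: "l \<noteq> 0"
    using exp_l ab by (metis exp_zero divide_eq_1_iff)
  have delta: "delta B D w i = 1 / l + b / (b - a)"
  proof -
    have "1 / (1 - exp l) = b / (b - a)"
      unfolding exp_l using ab by (simp add: field_simps)
    then show ?thesis using l0 by (simp add: delta_def l_def)
  qed
  \<comment> \<open>The \<open>1 / l\<close> terms, multiplied by \<open>l\<close>, cancel the
    diffusive difference \<open>y - x\<close>. What remains is
    \<open>l * (b * x - a * y) / (b - a)\<close>.\<close>
  have key: "l * ((1 - (1 / l + b / (b - a))) * y + (1 / l + b / (b - a)) * x) + (y - x)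
      = b * a / (b - a) * (- l) * (y / b - x / a)" for x y :: real
    using ab l0 by (simp add: divide_simps) (simp add: algebra_simps)
  have "num_flux B D w dw g i = D_mid D w dw i / dw *
      (l * ((1 - delta B D w i) * g (Suc i) + delta B D w i * g i) + (g (Suc i) - g i))"
    by (simp add: num_flux_def C_tilde_def l_def add_divide_distrib diff_divide_distrib algebra_simps)
  also have "\<dots> = D_mid D w dw i / dw * (b * a / (b - a) * (- l) * (g (Suc i) / b - g i / a))"
    unfolding delta key ..
  also have "b * a / (b - a) * (- l) = f_hat ginf i"
    using False ln_ba by (simp add: f_hat_def a_def b_def)
  finally show ?thesis by (simp add: a_def b_def)
qed

text \<open>Summation by parts; the zero fluxes at both ends leave no boundary terms.\<close>

lemma sum_flux_by_parts:
  "(\<Sum>i\<le>N. (right_flux B D w dw N g i - left_flux B D w dw g i) * h i)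
    = - (\<Sum>i<N. num_flux B D w dw g i * (h (Suc i) - h i))"
proof -
  have "(\<Sum>i\<le>N. right_flux B D w dw N g i * h i) = (\<Sum>i<N. num_flux B D w dw g i * h i)"
    by (simp add: lessThan_Suc_atMost[symmetric] right_flux_def)
  moreover have "(\<Sum>i\<le>N. left_flux B D w dw g i * h i) = (\<Sum>i<N. num_flux B D w dw g i * h (Suc i))"
    \<comment> \<open>The split-off term \<open>i = 0\<close> is zero; in the others the shift turns
      the index \<open>i - 1\<close> into \<open>i\<close>.\<close>
    unfolding lessThan_Suc_atMost[symmetric] sum.lessThan_Suc_shift by (simp add: left_flux_def)
  ultimately show ?thesis
    by (simp add: algebra_simps sum_subtractf)
qed

lemma diff_ln_mult_diff_nonneg:
  fixes x y :: real
  assumes "0 < x" "0 < y"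
  shows "0 \<le> (ln y - ln x) * (y - x)"
  using assms by (cases "x \<le> y") (auto intro!: mult_nonneg_nonneg mult_nonpos_nonpos)

lemma I_Delta_nonneg:
  assumes "uniform_grid w N dw" "diffusion_function D"
    and "\<And>i. i \<le> N \<Longrightarrow> 0 < g i" "\<And>i. i \<le> N \<Longrightarrow> 0 < ginf i"
  shows "0 \<le> I_Delta D w dw N g ginf"
  unfolding I_Delta_def
proof (rule sum_nonneg)
  fix i assume "i \<in> {..<N}"
  then have i: "i < N" "Suc i \<le> N" "i \<le> N" by auto
  show "0 \<le> (ln (g (Suc i) / ginf (Suc i)) - ln (g i / ginf i))
      * (g (Suc i) / ginf (Suc i) - g i / ginf i) * f_hat ginf i * D_mid D w dw i"
    using diff_ln_mult_diff_nonneg[of "g i / ginf i" "g (Suc i) / ginf (Suc i)"]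
      f_hat_pos[of ginf i] D_mid_pos[OF assms(1,2) i(1)] assms(3,4) i
    by (simp add: less_imp_le)
qed

text \<open>The function \<open>x * ln (x / c)\<close> has derivative \<open>ln (x / c) + 1\<close>
  for positive \<open>x\<close> and \<open>c\<close>.\<close>

lemma has_real_derivative_H_Delta:
  assumes "\<And>i. i \<le> N \<Longrightarrow> (f i has_real_derivative f' i) (at t within T)"
    and "\<And>i. i \<le> N \<Longrightarrow> 0 < f i t" "\<And>i. i \<le> N \<Longrightarrow> 0 < ginf i"
  shows "((\<lambda>s. H_Delta dw N (\<lambda>i. f i s) ginf) has_real_derivative
    dw * (\<Sum>i\<le>N. f' i * (ln (f i t / ginf i) + 1))) (at t within T)"
  unfolding H_Delta_def
proof (intro DERIV_cmult DERIV_sum)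
  fix i assume "i \<in> {..N}"
  then have i: "(f i has_real_derivative f' i) (at t within T)" "0 < f i t" "0 < ginf i"
    using assms by auto
  show "((\<lambda>s. f i s * ln (f i s / ginf i)) has_real_derivative
      f' i * (ln (f i t / ginf i) + 1)) (at t within T)"
    by (rule derivative_eq_intros i refl | use i in \<open>simp add: field_simps; fail\<close>)+
qed

theorem theorem1:
  fixes D finf :: "real \<Rightarrow> real" and w :: "nat \<Rightarrow> real" and f :: "nat \<Rightarrow> real \<Rightarrow> real"
    and u dw :: real and N :: nat and T :: "real set"
  assumes u: "u \<in> {-1<..<1}"
    and grid: "uniform_grid w N dw"
    and D: "diffusion_function D"
    and lam_finite: "\<forall>i<N. drift_ratio (\<lambda>x. x - u) D integrable_on {w i..w (Suc i)}"
    and finf: "positive_stationary_state (\<lambda>x. x - u) D ({-1<..<1} \<union> {w 0..w N}) finf"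
    and T: "is_interval T"
    and pos: "\<forall>i\<le>N. \<forall>t\<in>T. 0 < f i t"
    and sol: "scheme_solution (\<lambda>x. x - u) D w dw N T f"
  shows "\<forall>t\<in>T.
      ((\<lambda>s. H_Delta dw N (\<lambda>i. f i s) (\<lambda>i. finf (w i))) has_real_derivative
         - (I_Delta D w dw N (\<lambda>i. f i t) (\<lambda>i. finf (w i)) / dw)) (at t within T)
      \<and> 0 \<le> I_Delta D w dw N (\<lambda>i. f i t) (\<lambda>i. finf (w i))"
proof (intro ballI conjI)
  fix t assume t: "t \<in> T"
  define ginf where "ginf = (\<lambda>i. finf (w i))"
  define g where "g = (\<lambda>i. f i t)"
  define F where "F = num_flux (\<lambda>x. x - u) D w dw g"
  \<comment> \<open>\<open>h i\<close> is the derivative of the entropy density at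
    \<open>g i\<close>; its constant 1 will cancel in the differences
    \<open>h (Suc i) - h i\<close>.\<close>
  define h where "h = (\<lambda>i. ln (g i / ginf i) + 1)"
  have dw: "0 < dw" using grid by (simp add: uniform_grid_def)
  have ginf_pos: "0 < ginf i" if "i \<le> N" for i
    using finf uniform_grid_mono[OF grid, of 0 i] uniform_grid_mono[OF grid, of i N] that
    by (simp add: positive_stationary_state_def ginf_def)
  have g_pos: "0 < g i" if "i \<le> N" for i
    using pos t that by (simp add: g_def)
  show "0 \<le> I_Delta D w dw N (\<lambda>i. f i t) (\<lambda>i. finf (w i))"
    using I_Delta_nonneg[OF grid D g_pos ginf_pos] by (simp add: g_def ginf_def)
  have flux: "F i = D_mid D w dw i / dw * f_hat ginf i * (g (Suc i) / ginf (Suc i) - g i / ginf i)"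
    if "i < N" for i
    unfolding F_def using lam_stationary[OF grid D finf _ that] ginf_pos that
    by (intro num_flux_eq_f_hat) (auto simp: ginf_def)
  \<comment> \<open>The weight \<open>dw\<close> of the entropy cancels the \<open>1 / dw\<close> of
    the scheme.\<close>
  have "dw * (\<Sum>i\<le>N. (right_flux (\<lambda>x. x - u) D w dw N g i - left_flux (\<lambda>x. x - u) D w dw g i) / dw * h i)
      = (\<Sum>i\<le>N. (right_flux (\<lambda>x. x - u) D w dw N g i - left_flux (\<lambda>x. x - u) D w dw g i) * h i)"
    using dw by (simp add: sum_distrib_left)
  also have "\<dots> = - (\<Sum>i<N. F i * (h (Suc i) - h i))"
    unfolding F_def by (rule sum_flux_by_parts)
  \<comment> \<open>The remaining \<open>1 / dw\<close> is the prefactor in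
    \<open>flux\<close>.\<close>
  also have "(\<Sum>i<N. F i * (h (Suc i) - h i)) = I_Delta D w dw N g ginf / dw"
    unfolding I_Delta_def sum_divide_distrib
    by (intro sum.cong refl) (simp add: flux h_def mult_ac)
  finally have sum_eq: "dw * (\<Sum>i\<le>N. (right_flux (\<lambda>x. x - u) D w dw N g i
      - left_flux (\<lambda>x. x - u) D w dw g i) / dw * h i) = - (I_Delta D w dw N g ginf / dw)" .
  have "((\<lambda>s. H_Delta dw N (\<lambda>i. f i s) ginf) has_real_derivative
      dw * (\<Sum>i\<le>N. (right_flux (\<lambda>x. x - u) D w dw N g i - left_flux (\<lambda>x. x - u) D w dw g i) / dw
        * (ln (f i t / ginf i) + 1))) (at t within T)"
    using sol pos t ginf_pos unfolding scheme_solution_def g_def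
    by (intro has_real_derivative_H_Delta) auto
  then show "((\<lambda>s. H_Delta dw N (\<lambda>i. f i s) (\<lambda>i. finf (w i))) has_real_derivative
      - (I_Delta D w dw N (\<lambda>i. f i t) (\<lambda>i. finf (w i)) / dw)) (at t within T)"
    using sum_eq by (simp add: h_def g_def ginf_def)
qed

end
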